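(* Let $h=\max\{\delta,\frac1\beta\}$ and $N_{\max}=\big\lfloor\frac{(R+h-\delta)^2}{h^2}\big\rfloor$. For any $C\in\mathcal C_{\alpha,\beta,D}$ with $q\in\mathrm{int}_\delta C$ and $\|x_0-q\|\le R$, the iteration $$x_{i+1}=x_i-h\,n_i,\qquad n_i\in SH_C(x_i),$$ must halt with $x_i\in\mathrm{int}\,C$ by some iteration $i\le N_{\max}$. Moreover, there exist (in some dimension) $C\in\mathcal C_{\alpha,\beta,D}$, $q\in\mathrm{int}_\delta C$, $x_0$ with $\|x_0-q\|\le R$, and a separating hyperplane oracle for $C$ (a rule selecting the vectors $n_i\in SH_C(x_i)$), such that every method of the form $$x_{i+1}=x_i-\sum_{j=0}^iH_{i,j}n_j,\qquad n_i\in SH_C(x_i),$$ with a lower triangular stepsize matrix $H$, has $x_0,\dots,x_{N_{\max}-1}\notin\mathrm{int}\,C$.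
   Context: $\|\cdot\|$ is the Euclidean norm; $B(x,r)$ is the closed ball. For a nonempty closed convex $C\subseteq\mathbb R^d$: $N_C(z)=\{v:\langle v,x-z\rangle\le0\ \forall x\in C\}$ for $z\in\mathrm{bdry}\,C$; $\mathrm{int}\,C$ is the interior; $\mathrm{int}_\delta C=\{x:B(x,\delta)\subseteq C\}$ (so $\mathrm{int}_0C=C$); $\mathrm{diam}(C)=\sup\{\|x-y\|:x,y\in C\}$. $C$ is $\beta$-smooth if $B(z-\frac1\beta n,\frac1\beta)\subseteq C$ for all $z\in\mathrm{bdry}\,C$ and unit $n\in N_C(z)$; $C$ is $\alpha$-strongly convex if $C\subseteq B(z-\frac1\alpha n,\frac1\alpha)$ for all such $z,n$ (every closed convex set is $\infty$-smooth and $0$-strongly convex; $1/\infty=0$). $\mathcal C_{\alpha,\beta,D}$ is the set of nonempty closed convex sets that are $\alpha$-strongly convex, $\beta$-smooth, with diameter at most $D\in[0,\infty]$. The set of (unit) separating hyperplanes of $C$ at $x\in\mathbb R^d$ is $SH_C(x)=\{n\in\mathbb R^d:\|n\|=1,\ \langle n,y-x\rangle\le0\ \forall y\in C\}$, which is nonempty exactly when $x\notin\mathrm{int}\,C$. A separating hyperplane method halts once an iterate $x_i$ lies in $\mathrm{int}\,C$. Parameters: $0\le\alpha\le\beta\le\infty$, $\beta>0$, $\delta\ge0$, $R\ge0$, with $h>0$, and such that the class of instances ($C\in\mathcal C_{\alpha,\beta,D}$ with $\mathrm{int}_\delta C\neq\emptyset$) is nonempty.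
   Formalization: For the lower bound, nonemptiness of the instance class is read as existence of an instance C other than the whole space R^d; if D=∞ and α>1/h only R^d qualifies, and then x_0 always lies in int C, so the bound fails once N_max≥1. *)

theory Defs
  imports "HOL-Analysis.Analysis"
begin

text \<open>
  The dimension is quantified inside the main statement, so \<open>\<real>\<^sup>d\<close> cannot be a type.  It is
  the carrier of the library topology \<^const>\<open>Euclidean_space\<close> \<open>d\<close>, i.e. the sequences
  \<open>nat \<Rightarrow> real\<close> vanishing from index \<open>d\<close> on; interior and boundary are taken
  in that topology.
\<close>

definition Rd :: "nat \<Rightarrow> (nat \<Rightarrow> real) set"
  where "Rd d = topspace (Euclidean_space d)"

definition ip :: "nat \<Rightarrow> (nat \<Rightarrow> real) \<Rightarrow> (nat \<Rightarrow> real) \<Rightarrow> real"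
  where "ip d x y = (\<Sum>k<d. x k * y k)"

definition enorm :: "nat \<Rightarrow> (nat \<Rightarrow> real) \<Rightarrow> real"
  where "enorm d x = L2_set x {..<d}"

definition edist :: "nat \<Rightarrow> (nat \<Rightarrow> real) \<Rightarrow> (nat \<Rightarrow> real) \<Rightarrow> real"
  where "edist d x y = enorm d (\<lambda>k. x k - y k)"

definition clball :: "nat \<Rightarrow> (nat \<Rightarrow> real) \<Rightarrow> real \<Rightarrow> (nat \<Rightarrow> real) set"
  where "clball d c r = {x \<in> Rd d. edist d x c \<le> r}"

definition interior_d :: "nat \<Rightarrow> (nat \<Rightarrow> real) set \<Rightarrow> (nat \<Rightarrow> real) set"
  where "interior_d d C = (Euclidean_space d) interior_of C"

definition boundary_d :: "nat \<Rightarrow> (nat \<Rightarrow> real) set \<Rightarrow> (nat \<Rightarrow> real) set"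
  where "boundary_d d C = (Euclidean_space d) frontier_of C"

definition inner_interior :: "nat \<Rightarrow> real \<Rightarrow> (nat \<Rightarrow> real) set \<Rightarrow> (nat \<Rightarrow> real) set"
  where "inner_interior d \<delta> C = {x \<in> Rd d. clball d x \<delta> \<subseteq> C}"

definition convex_d :: "(nat \<Rightarrow> real) set \<Rightarrow> bool"
  where "convex_d C \<longleftrightarrow>
    (\<forall>x\<in>C. \<forall>y\<in>C. \<forall>t. 0 \<le> t \<and> t \<le> 1 \<longrightarrow> (\<lambda>k. (1 - t) * x k + t * y k) \<in> C)"

definition diam_d :: "nat \<Rightarrow> (nat \<Rightarrow> real) set \<Rightarrow> ennreal"
  where "diam_d d C = (SUP x\<in>C. SUP y\<in>C. ennreal (edist d x y))"

definition normal_cone :: "nat \<Rightarrow> (nat \<Rightarrow> real) set \<Rightarrow> (nat \<Rightarrow> real) \<Rightarrow> (nat \<Rightarrow> real) set"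
  where "normal_cone d C z = {v \<in> Rd d. \<forall>x\<in>C. ip d v (\<lambda>k. x k - z k) \<le> 0}"

text \<open>
  Since \<open>1 / \<infinity> = 0\<close> in \<^typ>\<open>ennreal\<close>, \<open>inv_par \<infinity> = 0\<close>.  The value at
  \<open>0\<close> is a dummy (\<open>inv_par 0 = 0\<close>) and is never used: smoothness parameters
  are positive, and strong convexity treats \<open>\<alpha> = 0\<close> separately.
\<close>

definition inv_par :: "ennreal \<Rightarrow> real"
  where "inv_par \<kappa> = enn2real (1 / \<kappa>)"

definition smooth_set :: "nat \<Rightarrow> ennreal \<Rightarrow> (nat \<Rightarrow> real) set \<Rightarrow> bool"
  where "smooth_set d \<beta> C \<longleftrightarrow>
    (\<forall>z\<in>boundary_d d C. \<forall>n\<in>normal_cone d C z. enorm d n = 1 \<longrightarrow>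
       clball d (\<lambda>k. z k - inv_par \<beta> * n k) (inv_par \<beta>) \<subseteq> C)"

definition strongly_convex_set :: "nat \<Rightarrow> ennreal \<Rightarrow> (nat \<Rightarrow> real) set \<Rightarrow> bool"
  where "strongly_convex_set d \<alpha> C \<longleftrightarrow> \<alpha> = 0 \<or>
    (\<forall>z\<in>boundary_d d C. \<forall>n\<in>normal_cone d C z. enorm d n = 1 \<longrightarrow>
       C \<subseteq> clball d (\<lambda>k. z k - inv_par \<alpha> * n k) (inv_par \<alpha>))"

definition set_class :: "nat \<Rightarrow> ennreal \<Rightarrow> ennreal \<Rightarrow> ennreal \<Rightarrow> (nat \<Rightarrow> real) set set"
  where "set_class d \<alpha> \<beta> D =
    {C. C \<noteq> {} \<and> closedin (Euclidean_space d) C \<and> convex_d C \<and>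
        strongly_convex_set d \<alpha> C \<and> smooth_set d \<beta> C \<and> diam_d d C \<le> D}"

definition SH :: "nat \<Rightarrow> (nat \<Rightarrow> real) set \<Rightarrow> (nat \<Rightarrow> real) \<Rightarrow> (nat \<Rightarrow> real) set"
  where "SH d C x = {n \<in> Rd d. enorm d n = 1 \<and> (\<forall>y\<in>C. ip d n (\<lambda>k. y k - x k) \<le> 0)}"

text \<open>
  An oracle is a fixed selection of a separating hyperplane at every point where one exists;
  its values on the interior of \<open>C\<close> are irrelevant.
\<close>

definition sh_oracle ::
    "nat \<Rightarrow> (nat \<Rightarrow> real) set \<Rightarrow> ((nat \<Rightarrow> real) \<Rightarrow> (nat \<Rightarrow> real)) \<Rightarrow> bool"
  where "sh_oracle d C \<O> \<longleftrightarrow> (\<forall>x\<in>Rd d - interior_d d C. \<O> x \<in> SH d C x)"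

text \<open>
  Iterates are total sequences, but a method halts at its first iterate in the interior, so
  the update rule is imposed at step \<open>i\<close> only while \<open>running d C x i\<close>; what follows
  the first interior iterate is unconstrained.
\<close>

definition running ::
    "nat \<Rightarrow> (nat \<Rightarrow> real) set \<Rightarrow> (nat \<Rightarrow> nat \<Rightarrow> real) \<Rightarrow> nat \<Rightarrow> bool"
  where "running d C x i \<longleftrightarrow> (\<forall>j\<le>i. x j \<notin> interior_d d C)"

definition fixed_step_run ::
    "nat \<Rightarrow> (nat \<Rightarrow> real) set \<Rightarrow> real \<Rightarrow> (nat \<Rightarrow> nat \<Rightarrow> real) \<Rightarrow> (nat \<Rightarrow> nat \<Rightarrow> real) \<Rightarrow> bool"
  where "fixed_step_run d C h x n \<longleftrightarrow>
    (\<forall>i. running d C x i \<longrightarrow>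
       n i \<in> SH d C (x i) \<and> x (Suc i) = (\<lambda>k. x i k - h * n i k))"

text \<open>
  Only the entries \<open>H i j\<close> with \<open>j \<le> i\<close> enter, so quantifying over all \<open>H\<close> amounts to
  quantifying over lower triangular stepsize matrices.
\<close>

definition matrix_step_run ::
    "nat \<Rightarrow> (nat \<Rightarrow> real) set \<Rightarrow> ((nat \<Rightarrow> real) \<Rightarrow> (nat \<Rightarrow> real)) \<Rightarrow> (nat \<Rightarrow> nat \<Rightarrow> real) \<Rightarrow>
     (nat \<Rightarrow> nat \<Rightarrow> real) \<Rightarrow> (nat \<Rightarrow> nat \<Rightarrow> real) \<Rightarrow> bool"
  where "matrix_step_run d C \<O> H x n \<longleftrightarrow>
    (\<forall>i. running d C x i \<longrightarrow>
       n i = \<O> (x i) \<and> x (Suc i) = (\<lambda>k. x i k - (\<Sum>j\<le>i. H i j * n j k)))"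

text \<open>
  Nonemptiness of the class of instances, in some dimension.  The whole space has empty
  boundary, hence is vacuously \<open>\<alpha>\<close>-strongly convex for every \<open>\<alpha>\<close>; it must not be the
  only instance: for \<open>D = \<infinity>\<close>, \<open>\<alpha> > 1/h\<close> it is, every method then
  halts at once, and the lower bound fails as soon as \<open>N\<^sub>m\<^sub>a\<^sub>x \<ge> 1\<close>.
  A proper instance is therefore required.  (If \<open>D < \<infinity>\<close> or \<open>\<alpha> = 0\<close> this agrees
  with plain nonemptiness in positive dimension.)
\<close>

definition has_instance :: "ennreal \<Rightarrow> ennreal \<Rightarrow> ennreal \<Rightarrow> real \<Rightarrow> bool"
  where "has_instance \<alpha> \<beta> D \<delta> \<longleftrightarrow>
    (\<exists>d. \<exists>C\<in>set_class d \<alpha> \<beta> D. C \<noteq> Rd d \<and> inner_interior d \<delta> C \<noteq> {})"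

end

theory Submission
  imports Defs
begin

text \<open>
  Upper bound.  The step length \<open>h\<close> is chosen so that \<open>C\<close>, unless it is the whole space,
  contains a ball of radius \<open>h\<close> whose centre \<open>p\<close> is within \<open>h - \<delta>\<close> of \<open>q\<close>
  (\<open>inscribed_ball\<close>): if \<open>h = \<delta>\<close>, take \<open>p = q\<close>; otherwise, unless the ball around
  \<open>q\<close> already fits, walk from \<open>q\<close> to the nearest boundary point and use the ball of radius
  \<open>1/\<beta>\<close> that smoothness places there.
  A hyperplane separating an iterate from \<open>C\<close> has the whole inscribed ball on its far side,
  so the iterate lies at least \<open>h\<close> ahead of \<open>p\<close> in the direction of the normal, and moving back
  by \<open>h\<close> lowers the squared distance to \<open>p\<close> by at least \<open>h\<^sup>2\<close> (\<open>step_decrease\<close>).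
  Initially that squared distance is at most \<open>(R + h - \<delta>)\<^sup>2\<close>, so it would become
  negative after more than \<open>(R + h - \<delta>)\<^sup>2 / h\<^sup>2\<close> steps.

  Lower bound.  A proper instance contains a ball of radius \<open>h\<close> and has a unit normal at some
  boundary point, so the parameters satisfy \<open>2 h \<le> D\<close> and, for \<open>\<alpha> \<noteq> 0\<close>,
  \<open>h \<le> 1/\<alpha>\<close> (\<open>instance_bounds\<close>).  Under these conditions the ball of radius \<open>h\<close>
  itself belongs to the class (\<open>ball_in_set_class\<close>).  Let \<open>N\<close> be the
  integer part of \<open>(R + h - \<delta>)\<^sup>2 / h\<^sup>2\<close>.  In dimension at least \<open>N\<close>, start at a
  point with \<open>N\<close> coordinates equal to \<open>h\<close> and the others zero; its norm \<open>h \<surd>N\<close> is at most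
  \<open>R + h - \<delta>\<close>.  An oracle that
  answers with the basis vector of a coordinate that is at least \<open>h\<close> reveals a single
  coordinate per query.  A method that moves in the span of the answers therefore still has a
  coordinate equal to \<open>h\<close> after \<open>i < N\<close> steps, whatever its step sizes, and such a point
  is not interior to the ball (\<open>resisting_run\<close>).
\<close>

section \<open>Inner products on sequences\<close>

lemma Rd_iff: "x \<in> Rd d \<longleftrightarrow> (\<forall>k\<ge>d. x k = 0)"
  by (simp add: Rd_def topspace_Euclidean_space)

lemma ip_add: "ip d (\<lambda>k. a k + b k) c = ip d a c + ip d b c"
  by (simp add: ip_def algebra_simps sum.distrib)

lemma ip_diff: "ip d (\<lambda>k. a k - b k) c = ip d a c - ip d b c"
  by (simp add: ip_def algebra_simps sum_subtractf)

lemma ip_scale: "ip d (\<lambda>k. s * a k) c = s * ip d a c"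
  by (simp add: ip_def algebra_simps sum_distrib_left)

lemma ip_commute: "ip d a b = ip d b a"
  by (simp add: ip_def mult.commute)

lemma ip_add_right: "ip d c (\<lambda>k. a k + b k) = ip d c a + ip d c b"
  by (metis ip_add ip_commute)

lemma ip_diff_right: "ip d c (\<lambda>k. a k - b k) = ip d c a - ip d c b"
  by (metis ip_diff ip_commute)

lemma ip_scale_right: "ip d c (\<lambda>k. s * a k) = s * ip d c a"
  by (metis ip_scale ip_commute)

lemmas ip_simps = ip_add ip_diff ip_scale ip_add_right ip_diff_right ip_scale_right

lemma enorm_sq: "(enorm d x)\<^sup>2 = ip d x x"
  by (simp add: enorm_def ip_def L2_set_def sum_nonneg power2_eq_square)

lemma enorm_nonneg [simp]: "0 \<le> enorm d x"
  by (simp add: enorm_def)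

lemma edist_nonneg [simp]: "0 \<le> edist d x y"
  by (simp add: edist_def)

lemma edist_self [simp]: "edist d x x = 0"
  by (simp add: edist_def enorm_def L2_set_def)

lemma enorm_scale: "enorm d (\<lambda>k. s * a k) = \<bar>s\<bar> * enorm d a"
  by (simp add: enorm_def L2_set_def power_mult_distrib real_sqrt_mult flip: sum_distrib_left)

lemma ip_le_enorm: "ip d x y \<le> enorm d x * enorm d y"
proof -
  have "ip d x y \<le> (\<Sum>k<d. \<bar>x k\<bar> * \<bar>y k\<bar>)"
    unfolding ip_def by (intro sum_mono) (metis abs_ge_self abs_mult)
  then show ?thesis
    unfolding enorm_def using L2_set_mult_ineq[of x y "{..<d}"] by linarith
qed

lemma enorm_triangle: "enorm d (\<lambda>k. x k + y k) \<le> enorm d x + enorm d y"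
  unfolding enorm_def by (rule L2_set_triangle_ineq)

lemma edist_triangle: "edist d x z \<le> edist d x y + edist d y z"
  using enorm_triangle[of d "\<lambda>k. x k - y k" "\<lambda>k. y k - z k"] by (simp add: edist_def)

lemma edist_commute: "edist d x y = edist d y x"
  using enorm_scale[of d "-1" "\<lambda>k. x k - y k"] by (simp add: edist_def)

lemma clball_subset_clball:
  assumes "edist d c c' + r \<le> s"
  shows "clball d c r \<subseteq> clball d c' s"
proof
  fix y assume "y \<in> clball d c r"
  then show "y \<in> clball d c' s"
    using edist_triangle[of d y c' c] assms by (auto simp: clball_def)
qed

lemma edist_sq: "(edist d x y)\<^sup>2 = ip d x x - 2 * ip d x y + ip d y y"
  unfolding edist_def enorm_sq by (simp add: ip_simps ip_commute)

lemma edist_le_imp_eq: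
  assumes "x \<in> Rd d" "y \<in> Rd d" "edist d x y \<le> 0"
  shows "x = y"
proof -
  have "L2_set (\<lambda>k. x k - y k) {..<d} = 0"
    using assms(3) by (intro antisym) (simp_all add: edist_def enorm_def)
  then have "\<forall>k<d. x k = y k"
    by (simp add: L2_set_eq_0_iff)
  with assms show ?thesis
    by (metis Rd_iff ext not_less)
qed

lemma edist_along_unit:
  assumes "enorm d n = 1"
  shows "edist d (\<lambda>k. x k + s * n k) (\<lambda>k. x k + t * n k) = \<bar>s - t\<bar>"
proof -
  have "(\<lambda>k. x k + s * n k - (x k + t * n k)) = (\<lambda>k. (s - t) * n k)"
    by (simp add: algebra_simps)
  then show ?thesis
    using assms by (simp add: edist_def enorm_scale)
qed

section \<open>Topology of the carrier\<close>

lemma Euclidean_space_eq: "Euclidean_space d = subtopology euclidean (Rd d)"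
proof -
  have "Rd d = {x. \<forall>i\<ge>d. x i = 0}"
    by (auto simp: Rd_iff)
  then show ?thesis
    by (simp add: Euclidean_space_def euclidean_product_topology)
qed

lemma closedin_Rd_iff: "closedin (Euclidean_space d) C \<longleftrightarrow> closed C \<and> C \<subseteq> Rd d"
  by (simp add: closedin_Euclidean_space_iff Rd_def)

lemma closed_Rd: "closed (Rd d)"
  by (metis Rd_def closedin_Euclidean_imp_closed closedin_topspace)

lemma continuous_on_enorm [continuous_intros]:
  assumes "\<And>k. continuous_on S (\<lambda>x. f x k)"
  shows "continuous_on S (\<lambda>x. enorm d (f x))"
  unfolding enorm_def L2_set_def by (intro continuous_intros assms)

lemma continuous_on_edist:
  "continuous_on S (\<lambda>x::nat \<Rightarrow> real. edist d x y)"
  unfolding edist_def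
  by (intro continuous_intros continuous_on_subset[OF continuous_on_product_coordinates]) simp

lemma interior_d_iff:
  "x \<in> interior_d d C \<longleftrightarrow> (\<exists>U. open U \<and> x \<in> U \<and> x \<in> Rd d \<and> U \<inter> Rd d \<subseteq> C)"
  unfolding interior_d_def interior_of_def Euclidean_space_eq
  by (auto simp: openin_subtopology; blast)

lemma interior_subset: "interior_d d C \<subseteq> C"
  unfolding interior_d_def by (rule interior_of_subset)

lemma interior_dI:
  assumes "x \<in> Rd d" "0 < e" "clball d x e \<subseteq> C"
  shows "x \<in> interior_d d C"
  unfolding interior_d_iff
proof (intro exI[of _ "{y. edist d y x < e}"] conjI)
  have "continuous_on UNIV (\<lambda>y. edist d y x)"
    by (rule continuous_on_edist)
  then show "open {y. edist d y x < e}"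
    by (intro open_Collect_less) auto
  show "x \<in> {y. edist d y x < e}"
    using \<open>0 < e\<close> by simp
  show "{y. edist d y x < e} \<inter> Rd d \<subseteq> C"
    using assms(3) by (auto simp: clball_def)
qed (use assms in auto)

lemma closed_Rd_minus_interior: "closed (Rd d - interior_d d C)"
proof -
  have "closedin (Euclidean_space d) (Rd d - interior_d d C)"
    unfolding interior_d_def Rd_def by (intro closedin_diff) auto
  then show ?thesis
    by (simp add: closedin_Rd_iff)
qed

lemma boundary_d_eq:
  assumes "closedin (Euclidean_space d) C"
  shows "boundary_d d C = C - interior_d d C"
  using assms by (simp add: boundary_d_def interior_d_def frontier_of_def closure_of_closedin)

lemma continuous_on_segment:
  "continuous_on S (\<lambda>t::real. (\<lambda>k::nat. a k + t * v k :: real))"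
  by (intro continuous_on_coordinatewise_then_product continuous_intros)

lemma closed_clball: "closed (clball d c r)"
proof -
  have "continuous_on UNIV (\<lambda>y. edist d y c)"
    by (rule continuous_on_edist)
  then have "closed {y. edist d y c \<le> r}"
    by (intro closed_Collect_le) auto
  moreover have "clball d c r = Rd d \<inter> {y. edist d y c \<le> r}"
    by (auto simp: clball_def)
  ultimately show ?thesis
    by (simp add: closed_Int closed_Rd)
qed

text \<open>
  A closed bounded subset of the carrier lies in a product of compact intervals, so Tychonoff's
  theorem makes it compact.
\<close>

lemma compact_clball: "compact (clball d c r)"
proof -
  define B where "B = (\<Pi>\<^sub>E k\<in>UNIV. {- (\<bar>c k\<bar> + \<bar>r\<bar>) .. \<bar>c k\<bar> + \<bar>r\<bar>})"
  have "compactin (powertop_real UNIV) B"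
    unfolding B_def by (auto simp: compactin_PiE)
  then have "compact B"
    by (simp add: euclidean_product_topology)
  moreover note closed_clball[of d c r]
  moreover have "clball d c r \<subseteq> B"
  proof
    fix y assume y: "y \<in> clball d c r"
    have "\<bar>y k\<bar> \<le> \<bar>c k\<bar> + \<bar>r\<bar>" for k
    proof (cases "k < d")
      case True
      have "\<bar>y k - c k\<bar> \<le> edist d y c"
        using member_le_L2_set[of "{..<d}" k "\<lambda>k. \<bar>y k - c k\<bar>"] True
        by (simp add: edist_def enorm_def L2_set_def)
      then show ?thesis
        using y by (auto simp: clball_def)
    next
      case False
      then have "y k = 0"
        using y by (auto simp: clball_def Rd_iff)
      then show ?thesis
        by simp
    qed
    then show "y \<in> B"
      unfolding B_def PiE_UNIV_domain Pi_iff by (simp add: abs_le_iff) (smt (verit))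
  qed
  ultimately show ?thesis
    by (metis compact_Int_closed inf.absorb_iff2)
qed

lemma nearest_point_exists:
  assumes "closed S" "S \<subseteq> Rd d" "S \<noteq> {}"
  obtains c where "c \<in> S" "\<And>y. y \<in> S \<Longrightarrow> edist d c q \<le> edist d y q"
proof -
  obtain s where s: "s \<in> S" using assms by auto
  have "compact (clball d q (edist d s q) \<inter> S)"
    by (intro compact_Int_closed compact_clball assms)
  moreover have "clball d q (edist d s q) \<inter> S \<noteq> {}"
    using s assms by (auto simp: clball_def)
  ultimately obtain c where "c \<in> clball d q (edist d s q) \<inter> S"
    and c: "\<forall>y\<in>clball d q (edist d s q) \<inter> S. edist d c q \<le> edist d y q"
    using continuous_attains_inf[OF _ _ continuous_on_edist] by metis
  moreover have "edist d c q \<le> edist d y q" if "y \<in> S" for y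
    using that c assms calculation by (cases "edist d y q \<le> edist d s q") (auto simp: clball_def)
  ultimately show ?thesis
    using that by blast
qed

section \<open>Separation\<close>

text \<open>
  The residual of the projection \<open>c\<close> of \<open>p\<close> onto \<open>C\<close> is a normal: moving from \<open>c\<close>
  a little towards any point of \<open>C\<close> must not decrease the distance to \<open>p\<close>.
\<close>

lemma separating_normal_outside:
  assumes C: "closed C" "C \<subseteq> Rd d" "C \<noteq> {}" "convex_d C" and p: "p \<in> Rd d" "p \<notin> C"
  shows "SH d C p \<noteq> {}"
proof -
  obtain c where c: "c \<in> C" "\<And>y. y \<in> C \<Longrightarrow> edist d c p \<le> edist d y p"
    using nearest_point_exists[OF C(1-3)] by metis
  define m where "m = edist d p c"
  have mpos: "0 < m"
    using edist_le_imp_eq[of p d c] c(1) p C(2) unfolding m_def by force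
  define n where "n = (\<lambda>k. (1 / m) * (p k - c k))"
  have "enorm d n = 1"
    unfolding n_def enorm_scale using mpos by (simp add: m_def edist_def)
  moreover have "n \<in> Rd d"
    using p c C by (auto simp: n_def Rd_iff subset_iff)
  moreover have "ip d n (\<lambda>k. y k - p k) \<le> 0" if y: "y \<in> C" for y
  proof -
    let ?w = "\<lambda>k. p k - c k" and ?v = "\<lambda>k. y k - c k"
    have t: "2 * ip d ?w ?v \<le> t * ip d ?v ?v" if "0 < t" "t \<le> 1" for t
    proof -
      let ?u = "\<lambda>k. (1 - t) * c k + t * y k"
      have "?u \<in> C"
        using C(4) c(1) y that unfolding convex_d_def by auto
      then have "(edist d c p)\<^sup>2 \<le> (edist d ?u p)\<^sup>2"
        using c(2) by (intro power_mono) auto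
      moreover have "(edist d ?u p)\<^sup>2 = (edist d c p)\<^sup>2 - 2 * t * ip d ?w ?v + t\<^sup>2 * ip d ?v ?v"
        unfolding edist_sq by (simp add: ip_simps ip_commute algebra_simps power2_eq_square)
      ultimately have "t * (2 * ip d ?w ?v) \<le> t * (t * ip d ?v ?v)"
        by (simp add: power2_eq_square algebra_simps)
      then show ?thesis
        using \<open>0 < t\<close> by simp
    qed
    have "ip d ?w ?v \<le> 0"
    proof (rule ccontr)
      assume neg: "\<not> ?thesis"
      have vv: "0 \<le> ip d ?v ?v"
        by (metis enorm_sq zero_le_power2)
      \<comment> \<open>The quadratic in \<open>t\<close> is minimal at the ratio of the two inner products; the
        step is cut off at \<open>1\<close>, and the denominator is kept away from \<open>0\<close>.\<close>
      define t where "t = min 1 (ip d ?w ?v / (ip d ?v ?v + 1))"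
      have "0 < t" "t \<le> 1"
        using neg vv by (auto simp: t_def)
      moreover have "t \<le> ip d ?w ?v / (ip d ?v ?v + 1)"
        by (simp add: t_def)
      then have "t * (ip d ?v ?v + 1) \<le> ip d ?w ?v"
        using vv pos_le_divide_eq[of "ip d ?v ?v + 1" t] by simp
      ultimately show False
        using t[of t] neg by (simp add: algebra_simps)
    qed
    moreover have "ip d ?w (\<lambda>k. y k - p k) = ip d ?w ?v - ip d ?w ?w"
      by (simp add: ip_simps)
    moreover have "0 \<le> ip d ?w ?w"
      by (metis enorm_sq zero_le_power2)
    ultimately show ?thesis
      unfolding n_def ip_scale using mpos by (simp add: field_simps)
  qed
  ultimately show ?thesis
    by (auto simp: SH_def)
qed

text \<open>
  A point outside the interior is a limit of points outside \<open>C\<close>; since the unit sphere is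
  compact, the unit normals at these points have a limit, and separation passes to it.
\<close>

lemma separating_normal_exists:
  assumes C: "closed C" "C \<subseteq> Rd d" "C \<noteq> {}" "convex_d C" and z: "z \<in> Rd d" "z \<notin> interior_d d C"
  shows "SH d C z \<noteq> {}"
proof -
  have "\<exists>p. p \<in> Rd d \<and> p \<notin> C \<and> edist d p z \<le> 1 / real (Suc i)" for i
    using interior_dI[of z d "1 / real (Suc i)" C] z by (auto simp: clball_def)
  then obtain p where p: "\<And>i. p i \<in> Rd d" "\<And>i. p i \<notin> C"
    and pz: "\<And>i. edist d (p i) z \<le> 1 / real (Suc i)"
    by metis
  have "\<exists>n. n \<in> SH d C (p i)" for i
    using separating_normal_outside[OF C p(1,2)] by blast
  then obtain n where n: "\<And>i. n i \<in> SH d C (p i)"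
    by metis
  have "n i \<in> clball d (\<lambda>_. 0) 1" for i
    using n[of i] by (simp add: SH_def clball_def edist_def)
  then obtain m r where r: "strict_mono (r :: nat \<Rightarrow> nat)" and lim: "(n \<circ> r) \<longlonglongrightarrow> m"
    using compact_imp_seq_compact[OF compact_clball, of d "\<lambda>_. 0" 1]
    unfolding seq_compact_def by metis
  have inS: "n (r i) \<in> Rd d \<inter> {y. enorm d y = 1}" for i
    using n[of "r i"] by (simp add: SH_def)
  have cont: "continuous_on UNIV (\<lambda>y. enorm d y)"
    by (intro continuous_intros) simp
  have "closed (Rd d \<inter> {y. enorm d y = 1})"
    by (intro closed_Int closed_Rd closed_Collect_eq cont) simp
  then have mS: "m \<in> Rd d \<inter> {y. enorm d y = 1}"
    by (rule closed_sequentially[OF _ _ lim]) (use inS in auto)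
  have coord: "(\<lambda>i. n (r i) k) \<longlonglongrightarrow> m k" for k
    using continuous_on_tendsto_compose[OF continuous_on_product_coordinates[of k] lim]
    by (simp add: o_def)
  have "ip d m (\<lambda>k. y k - z k) \<le> 0" if y: "y \<in> C" for y
  proof (rule LIMSEQ_le)
    show "(\<lambda>i. ip d (n (r i)) (\<lambda>k. y k - z k)) \<longlonglongrightarrow> ip d m (\<lambda>k. y k - z k)"
      unfolding ip_def by (intro tendsto_intros coord)
    show "(\<lambda>i. 1 / real (Suc (r i))) \<longlonglongrightarrow> 0"
      using LIMSEQ_subseq_LIMSEQ[OF LIMSEQ_Suc[OF lim_1_over_n[where 'a=real]] r]
      by (simp add: o_def)
    have "ip d (n (r i)) (\<lambda>k. y k - z k) \<le> 1 / real (Suc (r i))" for i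
    proof -
      have "ip d (n (r i)) (\<lambda>k. y k - z k)
          = ip d (n (r i)) (\<lambda>k. y k - p (r i) k) + ip d (n (r i)) (\<lambda>k. p (r i) k - z k)"
        by (simp add: ip_simps)
      moreover have "ip d (n (r i)) (\<lambda>k. y k - p (r i) k) \<le> 0"
        using n[of "r i"] y by (auto simp: SH_def)
      moreover have "ip d (n (r i)) (\<lambda>k. p (r i) k - z k) \<le> edist d (p (r i)) z"
        using ip_le_enorm[of d "n (r i)" "\<lambda>k. p (r i) k - z k"] inS[of i]
        by (simp add: edist_def)
      ultimately show ?thesis
        using pz[of "r i"] by linarith
    qed
    then show "\<exists>N. \<forall>i\<ge>N. ip d (n (r i)) (\<lambda>k. y k - z k) \<le> 1 / real (Suc (r i))"
      by blast
  qed
  then show ?thesis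
    using mS by (auto simp: SH_def)
qed

section \<open>Inscribed balls\<close>

text \<open>
  Let \<open>z\<close> be the point of the complement of the interior closest to \<open>q\<close>, at distance \<open>r\<close>.
  The closed ball of radius \<open>r\<close> around \<open>q\<close> lies in \<open>C\<close>, so a normal \<open>n\<close> at \<open>z\<close>
  supports that ball too, and the only point of the ball at which the hyperplane can touch it is
  \<open>q + r n\<close>.  For \<open>r = 0\<close> the point \<open>q\<close> is itself on the boundary and the statement
  is that a normal exists there.
\<close>

lemma nearest_boundary_point:
  assumes C: "closed C" "C \<subseteq> Rd d" "convex_d C" "C \<noteq> Rd d" and q: "q \<in> C"
  obtains z n r where "z \<in> C" "z \<notin> interior_d d C" "n \<in> normal_cone d C z" "enorm d n = 1"
    "0 \<le> r" "z = (\<lambda>k. q k + r * n k)" "{y \<in> Rd d. edist d y q < r} \<subseteq> C"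
proof -
  have "Rd d - interior_d d C \<noteq> {}"
    using interior_subset[of d C] C by auto
  then obtain z where z: "z \<in> Rd d" "z \<notin> interior_d d C"
    and zmin: "\<And>y. y \<in> Rd d - interior_d d C \<Longrightarrow> edist d z q \<le> edist d y q"
    using nearest_point_exists[OF closed_Rd_minus_interior[of d C], of d q] by blast
  define r where "r = edist d z q"
  have ball: "y \<in> C" if "y \<in> Rd d" "edist d y q < r" for y
    using zmin[of y] that interior_subset[of d C] by (force simp: r_def)
  \<comment> \<open>Minimality of \<open>z\<close> gives only the open ball; since \<open>C\<close> is closed, points of the sphere are
    reached along their radii.\<close>
  have sphere: "(\<lambda>k. q k + v k) \<in> C" if v: "v \<in> Rd d" "enorm d v \<le> r" for v
  proof (cases "enorm d v = 0")
    case True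
    then have "(\<lambda>k. q k + v k) = q"
      using v q C(2) by (intro edist_le_imp_eq[of _ d]) (auto simp: edist_def Rd_iff subset_iff)
    then show ?thesis
      using q by simp
  next
    case False
    then have vpos: "0 < enorm d v"
      using enorm_nonneg[of d v] by linarith
    let ?f = "\<lambda>t. (\<lambda>k. q k + t * v k)"
    have "?f ` closure {0..<1} \<subseteq> C"
    proof (rule image_closure_subset[OF continuous_on_segment \<open>closed C\<close>])
      have "?f t \<in> C" if "0 \<le> t" "t < 1" for t
      proof (rule ball)
        show "?f t \<in> Rd d"
          using q v C(2) by (auto simp: Rd_iff subset_iff)
        have "edist d (?f t) q = t * enorm d v"
          using that by (simp add: edist_def enorm_scale)
        also have "\<dots> < 1 * enorm d v"
          using that vpos by (intro mult_strict_right_mono)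
        finally show "edist d (?f t) q < r"
          using v by simp
      qed
      then show "?f ` {0..<1} \<subseteq> C"
        by auto
    qed
    moreover have "(1::real) \<in> closure {0..<1}"
      by simp
    ultimately have "?f 1 \<in> C"
      by blast
    then show ?thesis
      by simp
  qed
  have zq: "(\<lambda>k. z k - q k) \<in> Rd d"
    using q z C(2) by (auto simp: Rd_iff subset_iff)
  have zC: "z \<in> C"
    using sphere[OF zq] by (simp add: r_def edist_def)
  obtain n where "n \<in> SH d C z"
    using separating_normal_exists[OF C(1,2) _ C(3) z] q by blast
  then have n: "n \<in> Rd d" "enorm d n = 1" "\<And>y. y \<in> C \<Longrightarrow> ip d n (\<lambda>k. y k - z k) \<le> 0"
    by (auto simp: SH_def)
  have nn: "ip d n n = 1"
    using n(2) enorm_sq[of d n] by simp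
  have r0: "0 \<le> r"
    by (simp add: r_def)
  have "(\<lambda>k. q k + r * n k) \<in> C"
    using n r0 by (intro sphere) (auto simp: Rd_iff enorm_scale)
  from n(3)[OF this] have "r \<le> ip d n z - ip d n q"
    using nn by (simp add: ip_simps)
  then have "r * r \<le> r * (ip d n z - ip d n q)"
    using r0 by (intro mult_left_mono)
  moreover have "ip d z z - 2 * ip d z q + ip d q q = r * r"
    using edist_sq[of d z q] by (simp add: r_def power2_eq_square)
  moreover have "(edist d z (\<lambda>k. q k + r * n k))\<^sup>2
      = (ip d z z - 2 * ip d z q + ip d q q) - 2 * (r * (ip d n z - ip d n q)) + r * r"
    unfolding edist_sq using nn
    by (simp add: ip_simps ip_commute[of d z n] ip_commute[of d q n] algebra_simps)
  ultimately have "(edist d z (\<lambda>k. q k + r * n k))\<^sup>2 \<le> 0"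
    by linarith
  then have "edist d z (\<lambda>k. q k + r * n k) \<le> 0"
    by simp
  then have "z = (\<lambda>k. q k + r * n k)"
    using z n q C(2) by (intro edist_le_imp_eq) (auto simp: Rd_iff subset_iff)
  moreover have "n \<in> normal_cone d C z"
    using n by (simp add: normal_cone_def)
  ultimately show thesis
    using that zC z(2) n(2) r0 ball by blast
qed

text \<open>
  When \<open>h = 1/\<beta> > \<delta>\<close> and the boundary is at distance \<open>r \<le> h\<close> from \<open>q\<close>, the ball
  provided by smoothness is centred at \<open>z - h n = q - (h - r) n\<close>.  Its distance
  \<open>h - r\<close> to \<open>q\<close> is at most \<open>h - \<delta>\<close>, because the ball of radius \<open>\<delta>\<close> around \<open>q\<close>
  lies in \<open>C\<close> and so \<open>\<delta> \<le> r\<close>.  If \<open>r > h\<close>, the ball around \<open>q\<close> itself fits.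
\<close>

lemma inscribed_ball:
  assumes C: "closedin (Euclidean_space d) C" "convex_d C" "C \<noteq> Rd d" "smooth_set d \<beta> C"
    and q: "q \<in> inner_interior d \<delta> C" and "0 \<le> \<delta>" and h: "h = max \<delta> (inv_par \<beta>)"
  obtains p where "p \<in> Rd d" "clball d p h \<subseteq> C" "edist d p q \<le> h - \<delta>"
proof (cases "inv_par \<beta> \<le> \<delta>")
  case True
  then show ?thesis
    using that[of q] q h True by (simp add: inner_interior_def)
next
  case False
  then have h': "h = inv_par \<beta>"
    using h by simp
  have cl: "closed C" "C \<subseteq> Rd d"
    using C(1) by (auto simp: closedin_Rd_iff)
  have qRd: "q \<in> Rd d" and qball: "clball d q \<delta> \<subseteq> C"
    using q by (auto simp: inner_interior_def)
  have qC: "q \<in> C"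
    using qball qRd \<open>0 \<le> \<delta>\<close> by (auto simp: clball_def)
  obtain z n r where z: "z \<in> C" "z \<notin> interior_d d C" and n: "n \<in> normal_cone d C z" "enorm d n = 1"
    and r: "0 \<le> r" "z = (\<lambda>k. q k + r * n k)"
    and ball: "{y \<in> Rd d. edist d y q < r} \<subseteq> C"
    by (rule nearest_boundary_point[OF cl C(2,3) qC])
  show ?thesis
  proof (cases "h < r")
    case True
    then have "clball d q h \<subseteq> C"
      using ball by (auto simp: clball_def)
    then show ?thesis
      using that[of q] qRd h by simp
  next
    case False
    have zq: "edist d z q = r"
      using edist_along_unit[OF n(2), of q r 0] r by simp
    have "\<delta> \<le> r"
    proof (rule ccontr)
      assume "\<not> \<delta> \<le> r"
      moreover have "clball d z (\<delta> - r) \<subseteq> clball d q \<delta>"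
        using clball_subset_clball[of d z q "\<delta> - r" \<delta>] zq by simp
      ultimately show False
        using interior_dI[of z d "\<delta> - r" C] qball z cl by auto
    qed
    let ?p = "\<lambda>k. z k - h * n k"
    have "clball d ?p h \<subseteq> C"
      using C(4) n z unfolding smooth_set_def boundary_d_eq[OF C(1)] h' by auto
    moreover have "?p = (\<lambda>k. q k + (r - h) * n k)"
      using r by (simp add: algebra_simps)
    then have "edist d ?p q = \<bar>r - h\<bar>"
      using edist_along_unit[OF n(2), of q "r - h" 0] by simp
    moreover have "?p \<in> Rd d"
      using z n cl by (auto simp: normal_cone_def Rd_iff subset_iff)
    ultimately show ?thesis
      using that[of ?p] \<open>\<delta> \<le> r\<close> False by simp
  qed
qed

section \<open>The upper bound\<close>

text \<open>
  Applying separation to \<open>p + h n\<close>, the point of the inscribed ball that is furthest along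
  \<open>n\<close>, gives \<open>\<langle>n, x - p\<rangle> \<ge> h\<close>.
\<close>

lemma step_decrease:
  assumes "p \<in> Rd d" "clball d p h \<subseteq> C" "0 \<le> h" "n \<in> SH d C x"
  shows "(edist d (\<lambda>k. x k - h * n k) p)\<^sup>2 \<le> (edist d x p)\<^sup>2 - h\<^sup>2"
proof -
  have n: "n \<in> Rd d" "enorm d n = 1" "\<And>y. y \<in> C \<Longrightarrow> ip d n (\<lambda>k. y k - x k) \<le> 0"
    using assms(4) by (auto simp: SH_def)
  have nn: "ip d n n = 1"
    using n(2) enorm_sq[of d n] by simp
  have "(\<lambda>k. p k + h * n k) \<in> clball d p h"
    using edist_along_unit[OF n(2), of p h 0] assms n by (auto simp: clball_def Rd_iff)
  then have "ip d n (\<lambda>k. p k + h * n k - x k) \<le> 0"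
    using n(3) assms(2) by blast
  then have "h \<le> ip d n x - ip d n p"
    using nn by (simp add: ip_simps)
  then have "h * h \<le> h * (ip d n x - ip d n p)"
    using assms(3) by (intro mult_left_mono)
  moreover have "(edist d (\<lambda>k. x k - h * n k) p)\<^sup>2
      = (edist d x p)\<^sup>2 - 2 * h * (ip d n x - ip d n p) + h\<^sup>2"
    unfolding edist_sq using nn
    by (simp add: ip_simps ip_commute[of d x n] algebra_simps power2_eq_square)
  ultimately show ?thesis
    by (simp add: power2_eq_square)
qed

lemma fixed_step_halts:
  assumes p: "p \<in> Rd d" "clball d p h \<subseteq> C" and "0 < h" and start: "edist d (x 0) p \<le> \<rho>"
    and run: "fixed_step_run d C h x n"
  shows "\<exists>i\<le>nat \<lfloor>\<rho>\<^sup>2 / h\<^sup>2\<rfloor>. x i \<in> interior_d d C"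
proof (rule ccontr)
  define N where "N = nat \<lfloor>\<rho>\<^sup>2 / h\<^sup>2\<rfloor>"
  assume "\<not> ?thesis"
  then have running: "running d C x i" if "i \<le> N" for i
    using that by (auto simp: running_def N_def)
  have dist: "(edist d (x i) p)\<^sup>2 \<le> \<rho>\<^sup>2 - real i * h\<^sup>2" if "i \<le> Suc N" for i
    using that
  proof (induction i)
    case 0
    show ?case
      using power_mono[OF start edist_nonneg, of 2] by simp
  next
    case (Suc i)
    then have "n i \<in> SH d C (x i)" "x (Suc i) = (\<lambda>k. x i k - h * n i k)"
      using run running[of i] by (auto simp: fixed_step_run_def)
    then show ?case
      using step_decrease[OF p, of "n i" "x i"] Suc \<open>0 < h\<close> by (simp add: algebra_simps)
  qed
  have "\<rho>\<^sup>2 / h\<^sup>2 < real (Suc N)"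
    unfolding N_def using real_nat_ceiling_ge[of "\<rho>\<^sup>2 / h\<^sup>2"] by linarith
  then have "\<rho>\<^sup>2 < real (Suc N) * h\<^sup>2"
    using \<open>0 < h\<close> by (simp add: field_simps)
  with dist[of "Suc N"] show False
    using zero_le_power2[of "edist d (x (Suc N)) p"] by linarith
qed

section \<open>The lower bound\<close>

text \<open>
  The diameter of the inscribed ball in the direction of some boundary normal is at most that of
  \<open>C\<close>, and at most that of the ball of radius \<open>1/\<alpha>\<close> that strong convexity puts around
  \<open>C\<close>.  Any unit vector would do for the diameter; a proper subset always supplies
  one as a boundary normal.
\<close>

lemma instance_bounds:
  assumes inst: "has_instance \<alpha> \<beta> D \<delta>" and "0 \<le> \<delta>" "h = max \<delta> (inv_par \<beta>)" "0 < h"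
  shows "ennreal (2 * h) \<le> D" and "\<alpha> = 0 \<or> h \<le> inv_par \<alpha>"
proof -
  obtain d C q where CC: "C \<in> set_class d \<alpha> \<beta> D" and "C \<noteq> Rd d" and q: "q \<in> inner_interior d \<delta> C"
    using inst by (auto simp: has_instance_def)
  then have C: "closedin (Euclidean_space d) C" "convex_d C" "C \<noteq> Rd d" "smooth_set d \<beta> C"
    and sc: "strongly_convex_set d \<alpha> C" and diam: "diam_d d C \<le> D" and "C \<noteq> {}"
    by (auto simp: set_class_def)
  have cl: "closed C" "C \<subseteq> Rd d"
    using C(1) by (auto simp: closedin_Rd_iff)
  obtain p where p: "p \<in> Rd d" "clball d p h \<subseteq> C"
    using inscribed_ball[OF C q assms(2,3)] by metis
  obtain y where "y \<in> C"
    using \<open>C \<noteq> {}\<close> by blast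
  obtain z n where z: "z \<in> C" "z \<notin> interior_d d C" "n \<in> normal_cone d C z" "enorm d n = 1"
    by (rule nearest_boundary_point[OF cl C(2,3) \<open>y \<in> C\<close>])
  have nRd: "n \<in> Rd d"
    using z by (simp add: normal_cone_def)
  let ?a = "\<lambda>k. p k + h * n k" and ?b = "\<lambda>k. p k + (- h) * n k"
  have ab: "?a \<in> C" "?b \<in> C"
    using edist_along_unit[OF z(4), of p h 0] edist_along_unit[OF z(4), of p "- h" 0] p nRd \<open>0 < h\<close>
    by (auto intro!: subsetD[OF p(2)] simp: clball_def Rd_iff)
  have dist: "edist d ?a ?b = 2 * h"
    using edist_along_unit[OF z(4), of p h "- h"] \<open>0 < h\<close> by simp
  have "ennreal (edist d ?a ?b) \<le> diam_d d C"
    unfolding diam_d_def by (rule SUP_upper2[OF ab(1)], rule SUP_upper2[OF ab(2)]) simp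
  then show "ennreal (2 * h) \<le> D"
    using diam dist by simp
  show "\<alpha> = 0 \<or> h \<le> inv_par \<alpha>"
  proof (cases "\<alpha> = 0")
    case False
    let ?c = "\<lambda>k. z k - inv_par \<alpha> * n k"
    have "C \<subseteq> clball d ?c (inv_par \<alpha>)"
      using sc z False unfolding strongly_convex_set_def boundary_d_eq[OF C(1)] by auto
    then have "edist d ?a ?c \<le> inv_par \<alpha>" "edist d ?b ?c \<le> inv_par \<alpha>"
      using ab by (auto simp: clball_def)
    then show ?thesis
      using edist_triangle[of d ?a ?b ?c] dist edist_commute[of d ?b ?c] by linarith
  qed simp
qed

lemma unit_normal_of_ball:
  assumes "z \<in> clball d (\<lambda>_. 0) h" "n \<in> normal_cone d (clball d (\<lambda>_. 0) h) z" "enorm d n = 1" "0 \<le> h"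
  shows "z = (\<lambda>k. h * n k)"
proof -
  have nn: "ip d n n = 1"
    using assms(3) enorm_sq[of d n] by simp
  have nRd: "n \<in> Rd d" and zRd: "z \<in> Rd d" and zh: "enorm d z \<le> h"
    using assms by (auto simp: normal_cone_def clball_def edist_def)
  have "(\<lambda>k. h * n k) \<in> clball d (\<lambda>_. 0) h"
    using nRd assms by (auto simp: clball_def Rd_iff edist_def enorm_scale)
  then have "ip d n (\<lambda>k. h * n k - z k) \<le> 0"
    using assms(2) by (auto simp: normal_cone_def)
  then have "h \<le> ip d n z"
    using nn by (simp add: ip_simps)
  then have "h * h \<le> h * ip d n z"
    using assms(4) by (intro mult_left_mono)
  moreover have "ip d z z \<le> h * h"
    using power_mono[OF zh enorm_nonneg, of 2] unfolding enorm_sq by (simp add: power2_eq_square)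
  moreover have "(edist d z (\<lambda>k. h * n k))\<^sup>2 = ip d z z - 2 * h * ip d n z + h * h"
    unfolding edist_sq using nn by (simp add: ip_simps ip_commute[of d z n])
  ultimately have "(edist d z (\<lambda>k. h * n k))\<^sup>2 \<le> 0"
    by simp
  then show ?thesis
    using nRd zRd by (intro edist_le_imp_eq) (auto simp: Rd_iff)
qed

text \<open>
  A slightly dilated copy \<open>(1 + t) x\<close> of an interior point \<open>x\<close> stays in the ball.
\<close>

lemma interior_ball_enorm_less:
  assumes "0 < h" and x: "x \<in> interior_d d (clball d (\<lambda>_. 0) h)"
  shows "enorm d x < h"
proof (rule ccontr)
  assume "\<not> enorm d x < h"
  then have big: "h \<le> enorm d x"
    by simp
  obtain U where U: "open U" "x \<in> U" "x \<in> Rd d" "U \<inter> Rd d \<subseteq> clball d (\<lambda>_. 0) h"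
    using x by (auto simp: interior_d_iff)
  let ?f = "\<lambda>t::real. (\<lambda>k. x k + t * x k)"
  have "open (?f -` U)"
    using continuous_on_open_vimage[of UNIV ?f] continuous_on_segment[of UNIV x x] U(1) by auto
  moreover have "0 \<in> ?f -` U"
    using U(2) by simp
  ultimately obtain e where e: "0 < e" "ball 0 e \<subseteq> ?f -` U"
    by (meson open_contains_ball)
  moreover have "e / 2 \<in> ball 0 e"
    using e(1) by simp
  ultimately have "?f (e / 2) \<in> U"
    by blast
  moreover have "?f (e / 2) \<in> Rd d"
    using U(3) by (auto simp: Rd_iff)
  moreover have "?f (e / 2) = (\<lambda>k. (1 + e / 2) * x k)"
    by (simp add: algebra_simps)
  ultimately have "enorm d (\<lambda>k. (1 + e / 2) * x k) \<le> h"
    using U(4) by (auto simp: clball_def edist_def)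
  then have "(1 + e / 2) * enorm d x \<le> h"
    using e(1) by (simp add: enorm_scale)
  moreover have "0 < e * enorm d x"
    using e(1) big assms(1) by simp
  ultimately show False
    using big by (simp add: algebra_simps)
qed

text \<open>
  The boundary point with normal \<open>n\<close> is \<open>h n\<close>, so the balls in the definitions of smoothness
  and strong convexity are centred at \<open>(h - 1/\<beta>) n\<close> and \<open>(h - 1/\<alpha>) n\<close>: both
  touch the sphere of radius \<open>h\<close> at \<open>h n\<close>, the former from inside and the latter as an
  enclosing ball.
\<close>

lemma ball_in_set_class:
  assumes "0 \<le> h" and b: "inv_par \<beta> \<le> h" and a: "\<alpha> = 0 \<or> h \<le> inv_par \<alpha>" and D: "ennreal (2 * h) \<le> D"
  shows "clball d (\<lambda>_. 0) h \<in> set_class d \<alpha> \<beta> D"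
proof -
  let ?o = "\<lambda>_::nat. 0::real"
  let ?C = "clball d ?o h"
  have closed: "closedin (Euclidean_space d) ?C"
    using closed_clball[of d ?o h] by (auto simp: closedin_Rd_iff clball_def)
  have normal: "z = (\<lambda>k. h * n k)"
    if "z \<in> boundary_d d ?C" "n \<in> normal_cone d ?C z" "enorm d n = 1" for z n
    using that unit_normal_of_ball[of z d h n] \<open>0 \<le> h\<close> by (simp add: boundary_d_eq[OF closed])
  have shift: "(\<lambda>k. h * n k - s * n k) = (\<lambda>k. (h - s) * n k)" for n s
    by (simp add: algebra_simps)
  have convex: "convex_d ?C"
    unfolding convex_d_def
  proof (intro ballI allI impI)
    fix x y and t :: real
    assume xy: "x \<in> ?C" "y \<in> ?C" and t: "0 \<le> t \<and> t \<le> 1"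
    have "enorm d (\<lambda>k. (1 - t) * x k + t * y k) \<le> (1 - t) * enorm d x + t * enorm d y"
      using enorm_triangle[of d "\<lambda>k. (1 - t) * x k" "\<lambda>k. t * y k"] t by (simp add: enorm_scale)
    also have "\<dots> \<le> (1 - t) * h + t * h"
      using xy t by (intro add_mono mult_left_mono) (auto simp: clball_def edist_def)
    finally show "(\<lambda>k. (1 - t) * x k + t * y k) \<in> ?C"
      using xy by (auto simp: clball_def edist_def Rd_iff algebra_simps)
  qed
  have "smooth_set d \<beta> ?C"
    unfolding smooth_set_def
  proof (intro ballI impI)
    fix z n assume zn: "z \<in> boundary_d d ?C" "n \<in> normal_cone d ?C z" "enorm d n = 1"
    show "clball d (\<lambda>k. z k - inv_par \<beta> * n k) (inv_par \<beta>) \<subseteq> ?C"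
      unfolding normal[OF zn] shift
      using b zn(3) by (intro clball_subset_clball) (simp add: edist_def enorm_scale)
  qed
  moreover have "strongly_convex_set d \<alpha> ?C"
    unfolding strongly_convex_set_def
  proof (cases "\<alpha> = 0")
    case False
    have "?C \<subseteq> clball d (\<lambda>k. z k - inv_par \<alpha> * n k) (inv_par \<alpha>)"
      if zn: "z \<in> boundary_d d ?C" "n \<in> normal_cone d ?C z" "enorm d n = 1" for z n
      unfolding normal[OF zn] shift
      using a False zn(3)
      by (intro clball_subset_clball, subst edist_commute) (simp add: edist_def enorm_scale)
    then show "\<alpha> = 0 \<or> (\<forall>z\<in>boundary_d d ?C. \<forall>n\<in>normal_cone d ?C z. enorm d n = 1 \<longrightarrow>
       ?C \<subseteq> clball d (\<lambda>k. z k - inv_par \<alpha> * n k) (inv_par \<alpha>))"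
      by blast
  qed simp
  moreover have "diam_d d ?C \<le> D"
    unfolding diam_d_def
  proof (intro SUP_least)
    fix x y assume "x \<in> ?C" "y \<in> ?C"
    then have "edist d x y \<le> 2 * h"
      using edist_triangle[of d x y ?o] edist_commute[of d y ?o] by (simp add: clball_def)
    then show "ennreal (edist d x y) \<le> D"
      using D by (meson ennreal_leI order_trans)
  qed
  moreover have "?o \<in> ?C"
    using \<open>0 \<le> h\<close> by (simp add: clball_def Rd_iff)
  ultimately show ?thesis
    using closed convex by (auto simp: set_class_def)
qed

definition basis_vec :: "nat \<Rightarrow> nat \<Rightarrow> real" where
  "basis_vec k = (\<lambda>j. if j = k then 1 else 0)"

text \<open>
  Where no coordinate reaches \<open>h\<close>, the answer is the radial direction, which separates any
  point outside the interior of the ball.  Runs from the hard starting point do not meet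
  this case in the steps that are counted, but an oracle must answer everywhere.
\<close>

definition resisting_oracle :: "nat \<Rightarrow> real \<Rightarrow> (nat \<Rightarrow> real) \<Rightarrow> nat \<Rightarrow> real" where
  "resisting_oracle d h x =
    (if \<exists>k<d. h \<le> x k then basis_vec (LEAST k. k < d \<and> h \<le> x k)
     else (\<lambda>k. (1 / enorm d x) * x k))"

lemma resisting_oracle_basis_vec:
  assumes "k < d" "h \<le> x k"
  obtains j where "j < d" "h \<le> x j" "resisting_oracle d h x = basis_vec j"
proof -
  have "(LEAST k. k < d \<and> h \<le> x k) < d \<and> h \<le> x (LEAST k. k < d \<and> h \<le> x k)"
    using LeastI[of "\<lambda>k. k < d \<and> h \<le> x k" k] assms by simp
  moreover have "resisting_oracle d h x = basis_vec (LEAST k. k < d \<and> h \<le> x k)"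
    using assms by (auto simp: resisting_oracle_def)
  ultimately show ?thesis
    using that by blast
qed

lemma coordinate_le_enorm: "k < d \<Longrightarrow> x k \<le> enorm d x"
  unfolding enorm_def by (rule member_le_L2_set) auto

lemma ip_basis_vec: "j < d \<Longrightarrow> ip d (basis_vec j) y = y j"
  by (simp add: ip_def basis_vec_def if_distrib[of "\<lambda>a. a * _"] cong: if_cong)

lemma sh_oracle_resisting:
  assumes "0 < h"
  shows "sh_oracle d (clball d (\<lambda>_. 0) h) (resisting_oracle d h)"
  unfolding sh_oracle_def
proof
  fix x assume x: "x \<in> Rd d - interior_d d (clball d (\<lambda>_. 0) h)"
  have small: "enorm d y \<le> h" if "y \<in> clball d (\<lambda>_. 0) h" for y
    using that by (simp add: clball_def edist_def)
  show "resisting_oracle d h x \<in> SH d (clball d (\<lambda>_. 0) h) x"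
  proof (cases "\<exists>k<d. h \<le> x k")
    case True
    then obtain j where j: "j < d" "h \<le> x j" "resisting_oracle d h x = basis_vec j"
      using resisting_oracle_basis_vec by metis
    have "(enorm d (basis_vec j))\<^sup>2 = 1"
      unfolding enorm_sq ip_basis_vec[OF j(1)] by (simp add: basis_vec_def)
    then have "enorm d (basis_vec j) = 1"
      using real_sqrt_unique[of "enorm d (basis_vec j)" 1] by simp
    moreover have "basis_vec j \<in> Rd d"
      using j by (simp add: basis_vec_def Rd_iff)
    moreover have "ip d (basis_vec j) (\<lambda>k. y k - x k) \<le> 0" if "y \<in> clball d (\<lambda>_. 0) h" for y
      using small[OF that] coordinate_le_enorm[OF j(1), of y] j by (simp add: ip_basis_vec)
    ultimately show ?thesis
      using j by (simp add: SH_def)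
  next
    case False
    let ?s = "enorm d x"
    have s: "h \<le> ?s"
    proof (rule ccontr)
      assume "\<not> h \<le> ?s"
      moreover have "clball d x (h - ?s) \<subseteq> clball d (\<lambda>_. 0) h"
        by (rule clball_subset_clball) (simp add: edist_def)
      ultimately show False
        using interior_dI[of x d "h - ?s"] x by auto
    qed
    have "ip d x (\<lambda>k. y k - x k) \<le> 0" if "y \<in> clball d (\<lambda>_. 0) h" for y
    proof -
      have "ip d x y \<le> ?s * ?s"
        using ip_le_enorm[of d x y] small[OF that] s
          mult_left_mono[of "enorm d y" ?s ?s] by fastforce
      then show ?thesis
        by (simp add: ip_simps power2_eq_square flip: enorm_sq)
    qed
    then have "ip d (\<lambda>k. (1 / ?s) * x k) (\<lambda>k. y k - x k) \<le> 0" if "y \<in> clball d (\<lambda>_. 0) h" for y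
      unfolding ip_scale using that s assms by (intro mult_nonneg_nonpos) auto
    moreover have "enorm d (\<lambda>k. (1 / ?s) * x k) = 1"
      unfolding enorm_scale using s assms by simp
    ultimately show ?thesis
      using x False by (auto simp: SH_def resisting_oracle_def Rd_iff)
  qed
qed

text \<open>
  The set \<open>K\<close> collects the coordinates revealed so far; every other coordinate below \<open>N\<close>
  still has its initial value, because the answers, and hence all moves, are supported on \<open>K\<close>.
\<close>

lemma resisting_run:
  assumes "0 < h" "N \<le> d" and x0: "\<And>k. k < N \<Longrightarrow> x 0 k = h"
    and run: "matrix_step_run d (clball d (\<lambda>_. 0) h) (resisting_oracle d h) H x n"
  shows "i < N \<Longrightarrow> x i \<notin> interior_d d (clball d (\<lambda>_. 0) h)"
proof -
  let ?int = "interior_d d (clball d (\<lambda>_. 0) h)"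
  have inv: "\<exists>K. finite K \<and> card K \<le> i \<and> (\<forall>j<i. x j \<notin> ?int) \<and>
      (\<forall>j<i. \<exists>k\<in>K. n j = basis_vec k) \<and> (\<forall>k<N. k \<notin> K \<longrightarrow> x i k = h)" if "i \<le> N" for i
    using that
  proof (induction i)
    case 0
    show ?case
      using x0 by (intro exI[of _ "{}"]) auto
  next
    case (Suc i)
    then obtain K where K: "finite K" "card K \<le> i" "\<forall>j<i. x j \<notin> ?int"
      "\<forall>j<i. \<exists>k\<in>K. n j = basis_vec k" "\<forall>k<N. k \<notin> K \<longrightarrow> x i k = h"
      by auto
    have "\<not> {..<N} \<subseteq> K"
      using card_mono[OF K(1), of "{..<N}"] K(2) Suc.prems by auto
    then obtain k where k: "k < N" "k \<notin> K"
      by auto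
    then have xk: "k < d" "h \<le> x i k"
      using K(5) assms(2) by auto
    have out: "x i \<notin> ?int"
      using interior_ball_enorm_less[OF assms(1), of "x i" d] coordinate_le_enorm[of k d "x i"] xk
      by fastforce
    then have "running d (clball d (\<lambda>_. 0) h) x i"
      using K(3) by (auto simp: running_def le_less)
    then have upd: "n i = resisting_oracle d h (x i)" "x (Suc i) = (\<lambda>k. x i k - (\<Sum>j\<le>i. H i j * n j k))"
      using run by (auto simp: matrix_step_run_def)
    obtain j where j: "n i = basis_vec j"
      using resisting_oracle_basis_vec[of k d h "x i"] xk upd(1) by metis
    have normals: "\<forall>m<Suc i. \<exists>k\<in>insert j K. n m = basis_vec k"
      using K(4) j by (auto simp: less_Suc_eq)
    have "x (Suc i) l = h" if "l < N" "l \<notin> insert j K" for l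
    proof -
      have "n m l = 0" if "m \<le> i" for m
        using normals \<open>l \<notin> insert j K\<close> that by (auto simp: basis_vec_def less_Suc_eq_le)
      then show ?thesis
        using K(5) that upd(2) by simp
    qed
    moreover have "card (insert j K) \<le> Suc i"
      using card_insert_le_m1[of "Suc i" K j] K(2) by simp
    ultimately show ?case
      using normals K(1,3) out by (intro exI[of _ "insert j K"]) (auto simp: less_Suc_eq)
  qed
  show "i < N \<Longrightarrow> x i \<notin> ?int"
    using inv[of N] by auto
qed

text \<open>
  The point \<open>q\<close> divides the segment from the centre of the ball to \<open>x0\<close> in the ratio
  \<open>(h - \<delta>) : R\<close>, so the bound \<open>R + h - \<delta>\<close> on the norm of \<open>x0\<close> splits into
  \<open>h - \<delta>\<close> for \<open>q\<close> and \<open>R\<close> for the remaining part.  If \<open>R + h - \<delta> = 0\<close>, both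
  points are the centre.
\<close>

lemma starting_points:
  assumes "\<delta> \<le> h" "0 \<le> R" and N: "real N * h\<^sup>2 \<le> (R + h - \<delta>)\<^sup>2" and "N \<le> d"
  obtains q x0 where "x0 \<in> Rd d" "edist d x0 q \<le> R" "q \<in> inner_interior d \<delta> (clball d (\<lambda>_. 0) h)"
    "\<And>k. k < N \<Longrightarrow> x0 k = h"
proof
  define \<rho> where "\<rho> = R + h - \<delta>"
  have \<rho>: "0 \<le> \<rho>" "h - \<delta> \<le> \<rho>" "\<rho> - (h - \<delta>) = R"
    using assms by (auto simp: \<rho>_def)
  let ?x0 = "\<lambda>k. if k < N then h else (0::real)"
  let ?t = "(h - \<delta>) / \<rho>"
  have "(enorm d ?x0)\<^sup>2 = (\<Sum>k<d. if k < N then h\<^sup>2 else 0)"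
    unfolding enorm_sq ip_def by (intro sum.cong) (auto simp: power2_eq_square)
  also have "\<dots> = (\<Sum>k<N. h\<^sup>2)"
    using \<open>N \<le> d\<close> by (intro sum.mono_neutral_cong_right) auto
  finally have "(enorm d ?x0)\<^sup>2 \<le> \<rho>\<^sup>2"
    using N by (simp add: \<rho>_def)
  then have x0: "enorm d ?x0 \<le> \<rho>"
    using \<rho>(1) power2_le_imp_le by blast
  have scaled: "s / \<rho> * enorm d ?x0 \<le> s" if "0 \<le> s" for s
  proof -
    have "s / \<rho> * enorm d ?x0 \<le> s / \<rho> * \<rho>"
      using that \<rho>(1) x0 by (intro mult_left_mono) auto
    also have "\<dots> \<le> s"
      using that by simp
    finally show ?thesis .
  qed
  show "?x0 \<in> Rd d"
    using \<open>N \<le> d\<close> by (auto simp: Rd_iff)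
  show "edist d ?x0 (\<lambda>k. ?t * ?x0 k) \<le> R"
  proof (cases "\<rho> = 0")
    case True
    then show ?thesis
      using x0 \<open>0 \<le> R\<close> by (simp add: edist_def)
  next
    case False
    have "1 - ?t = R / \<rho>"
      using False \<rho>(3) by (simp add: field_simps)
    then have "(\<lambda>k. ?x0 k - ?t * ?x0 k) = (\<lambda>k. (R / \<rho>) * ?x0 k)"
      using left_diff_distrib[of 1 ?t] by (simp only: mult_1)
    then show ?thesis
      using scaled[of R] \<open>0 \<le> R\<close> \<rho>(1) unfolding edist_def by (simp only: enorm_scale) simp
  qed
  have "clball d (\<lambda>k. ?t * ?x0 k) \<delta> \<subseteq> clball d (\<lambda>_. 0) h"
  proof (rule clball_subset_clball)
    have "edist d (\<lambda>k. ?t * ?x0 k) (\<lambda>_. 0) = ?t * enorm d ?x0"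
      using assms(1) \<rho>(1) unfolding edist_def diff_zero enorm_scale by simp
    then show "edist d (\<lambda>k. ?t * ?x0 k) (\<lambda>_. 0) + \<delta> \<le> h"
      using scaled[of "h - \<delta>"] assms(1) by simp
  qed
  then show "(\<lambda>k. ?t * ?x0 k) \<in> inner_interior d \<delta> (clball d (\<lambda>_. 0) h)"
    using \<open>N \<le> d\<close> by (auto simp: inner_interior_def Rd_iff)
qed simp

theorem theorem4p1:
  fixes \<alpha> \<beta> D :: ennreal and \<delta> R h :: real and Nmax :: nat
  assumes "\<alpha> \<le> \<beta>" and "0 < \<beta>" and "0 \<le> \<delta>" and "0 \<le> R"
    and "h = max \<delta> (inv_par \<beta>)" and "0 < h"
    and "Nmax = nat \<lfloor>(R + h - \<delta>)\<^sup>2 / h\<^sup>2\<rfloor>"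
  shows "(\<forall>d. \<forall>C\<in>set_class d \<alpha> \<beta> D. \<forall>q\<in>inner_interior d \<delta> C. \<forall>x n.
            x 0 \<in> Rd d \<and> edist d (x 0) q \<le> R \<and> fixed_step_run d C h x n \<longrightarrow>
            (\<exists>i\<le>Nmax. x i \<in> interior_d d C))
       \<and> (has_instance \<alpha> \<beta> D \<delta> \<longrightarrow>
          (\<exists>d\<ge>1. \<exists>C\<in>set_class d \<alpha> \<beta> D. \<exists>q\<in>inner_interior d \<delta> C. \<exists>x0\<in>Rd d.
            edist d x0 q \<le> R \<and>
            (\<exists>\<O>. sh_oracle d C \<O> \<and>
              (\<forall>H x n. x 0 = x0 \<and> matrix_step_run d C \<O> H x n \<longrightarrow>
                 (\<forall>i<Nmax. x i \<notin> interior_d d C)))))"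
proof (intro conjI allI ballI impI)
  fix d C q x n
  assume CC: "C \<in> set_class d \<alpha> \<beta> D" and q: "q \<in> inner_interior d \<delta> C"
    and run: "x 0 \<in> Rd d \<and> edist d (x 0) q \<le> R \<and> fixed_step_run d C h x n"
  show "\<exists>i\<le>Nmax. x i \<in> interior_d d C"
  proof (cases "C = Rd d")
    case True
    then have "interior_d d C = Rd d"
      by (simp add: interior_d_def Rd_def)
    then show ?thesis
      using run by auto
  next
    case False
    have "closedin (Euclidean_space d) C" "convex_d C" "smooth_set d \<beta> C"
      using CC by (auto simp: set_class_def)
    then obtain p where p: "p \<in> Rd d" "clball d p h \<subseteq> C" "edist d p q \<le> h - \<delta>"
      using inscribed_ball[OF _ _ False _ q assms(3,5)] by metis
    have "edist d (x 0) p \<le> R + h - \<delta>"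
      using edist_triangle[of d "x 0" p q] edist_commute[of d q p] run p(3) by simp
    then show ?thesis
      using fixed_step_halts[OF p(1,2) assms(6)] run assms(7) by blast
  qed
next
  assume inst: "has_instance \<alpha> \<beta> D \<delta>"
  \<comment> \<open>The dimension must be positive even when \<open>Nmax = 0\<close>.\<close>
  let ?d = "max 1 Nmax"
  let ?C = "clball ?d (\<lambda>_. 0) h"
  have hb: "\<delta> \<le> h" "inv_par \<beta> \<le> h" "0 \<le> h"
    using assms(5,6) by simp_all
  have C: "?C \<in> set_class ?d \<alpha> \<beta> D"
    using instance_bounds[OF inst assms(3,5,6)] hb(2,3) by (intro ball_in_set_class)
  have "real Nmax \<le> (R + h - \<delta>)\<^sup>2 / h\<^sup>2"
    unfolding assms(7) by (simp add: of_nat_floor)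
  then have "real Nmax * h\<^sup>2 \<le> (R + h - \<delta>)\<^sup>2"
    using assms(6) by (simp add: field_simps)
  then obtain q x0 where pts: "x0 \<in> Rd ?d" "edist ?d x0 q \<le> R" "q \<in> inner_interior ?d \<delta> ?C"
    and coords: "\<And>k. k < Nmax \<Longrightarrow> x0 k = h"
    using starting_points[OF hb(1) assms(4), of Nmax ?d] by (metis max.cobounded2)
  have runs: "\<forall>H x n. x 0 = x0 \<and> matrix_step_run ?d ?C (resisting_oracle ?d h) H x n \<longrightarrow>
                 (\<forall>i<Nmax. x i \<notin> interior_d ?d ?C)"
  proof (intro allI impI, elim conjE)
    fix H x n i
    assume "x 0 = x0" "matrix_step_run ?d ?C (resisting_oracle ?d h) H x n" "i < Nmax"
    then show "x i \<notin> interior_d ?d ?C"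
      using resisting_run[OF assms(6) max.cobounded2 _ \<open>matrix_step_run _ _ _ _ _ _\<close>] coords by simp
  qed
  have "1 \<le> ?d"
    by simp
  show "\<exists>d\<ge>1. \<exists>C\<in>set_class d \<alpha> \<beta> D. \<exists>q\<in>inner_interior d \<delta> C. \<exists>x0\<in>Rd d.
            edist d x0 q \<le> R \<and>
            (\<exists>\<O>. sh_oracle d C \<O> \<and>
              (\<forall>H x n. x 0 = x0 \<and> matrix_step_run d C \<O> H x n \<longrightarrow>
                 (\<forall>i<Nmax. x i \<notin> interior_d d C)))"
    by (intro exI[of _ ?d] conjI bexI[of _ ?C] bexI[of _ q] bexI[of _ x0]
        exI[of _ "resisting_oracle ?d h"]) (fact C pts runs sh_oracle_resisting[OF assms(6)] \<open>1 \<le> ?d\<close>)+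
qed

end
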